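(* Let $q$ be a power of an odd prime, let $d\geq 2$ and let $\mathcal{A}\subseteq\mathbb{F}_q$. Then \[ \sum_{l\in\mathbb{F}_q^{*}}N_d^2(\mathcal{A};l)\leq (1+o(1))\frac{|\mathcal{A}|^{2d^2}}{q}+q^{d-1}|\mathcal{A}|^{2d}(1+o(1))\sum_{t\in\mathbb{F}_q^{*}}N_{d-1}^2(\mathcal{A};t). \]
   Context: $\mathbb{F}_q$ is the finite field with $q$ elements. For a set $\mathcal{A}\subseteq\mathbb{F}_q$, an integer $k\ge1$ and $t\in\mathbb{F}_q$, $N_k(\mathcal{A};t)$ denotes the number of $k\times k$ matrices with all entries in $\mathcal{A}$ whose determinant equals $t$ (for $k=1$ this is $1$ if $t\in\mathcal{A}$ and $0$ otherwise). Here $o(1)$ denotes a quantity tending to $0$ as $|\mathcal{A}|\to\infty$, with $d$ fixed. *)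

theory Defs
  imports Complex_Main "HOL-Algebra.Ring" "HOL-Combinatorics.Permutations"
    "HOL-Computational_Algebra.Primes" "Jordan_Normal_Form.Matrix"
begin

text \<open>
  Finite fields are HOL-Algebra structures \<open>R\<close>, not types of class \<open>field\<close>: the asymptotic
  statement quantifies over all finite fields inside a formula, which is impossible for types.
  Accordingly the determinant is the Leibniz sum computed with the operations of \<open>R\<close>.
  It is meant for square matrices with entries in \<open>carrier R\<close>.
\<close>

definition ring_det :: "'a ring \<Rightarrow> 'a mat \<Rightarrow> 'a" where
  "ring_det R M =
     (\<Oplus>\<^bsub>R\<^esub>p \<in> {p. p permutes {0..<dim_row M}}.
        (if evenperm p then \<one>\<^bsub>R\<^esub> else \<ominus>\<^bsub>R\<^esub> \<one>\<^bsub>R\<^esub>)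
          \<otimes>\<^bsub>R\<^esub> (\<Otimes>\<^bsub>R\<^esub>i \<in> {0..<dim_row M}. M $$ (i, p i)))"

definition det_count :: "'a ring \<Rightarrow> nat \<Rightarrow> 'a set \<Rightarrow> 'a \<Rightarrow> nat" where
  "det_count R k A t = card {M \<in> carrier_mat k k. elements_mat M \<subseteq> A \<and> ring_det R M = t}"

end

theory Submission
  imports Defs "Jordan_Normal_Form.Determinant"
    "HOL-Algebra.Multiplicative_Group" "HOL-Analysis.Convex"
begin

text \<open>
  Write \<open>n = d - 1\<close> and expand along the first row: \<open>det = x \<cdot> w(X)\<close>, where \<open>w(X)\<close> is the vector of
  signed maximal minors of the remaining \<open>n \<times> d\<close> matrix \<open>X\<close>. Only the matrices with \<open>w(X) \<noteq> 0\<close>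
  matter for nonzero determinants. The second moment of \<open>l \<mapsto> #{(x, X). x \<cdot> w(X) = l}\<close> is its main term
  plus a variance, which by Cauchy-Schwarz is at most \<open>|A|^d\<close> times a sum over \<open>x \<in> A^d\<close> of variances
  invariant under scaling \<open>x\<close>. Averaging over scalars and extending the sum to all vectors \<open>x\<close> bounds
  it by \<open>q^n |A|^(d + 1)\<close> times the number of pairs with \<open>w(X) = w(X') \<noteq> 0\<close>.

  Since \<open>X w(X) = 0\<close>, such a pair is determined by the two minors at a position \<open>k\<close> with \<open>w_k \<noteq> 0\<close> and
  column \<open>k\<close> of \<open>X\<close>. Taking \<open>k\<close> to be the last position leaves \<open>|A|^n\<close> columns. If the last entry of
  \<open>w\<close> vanishes, the column lies in a hyperplane, so each other \<open>k\<close> contributes only \<open>|A|^(n - 1)\<close>.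
  This gives the theorem with \<open>\<epsilon>\<^sub>1 = 0\<close> and \<open>\<epsilon>\<^sub>2(k) = (d - 1) / k\<close>.
\<close>

section \<open>Transfer of determinant identities\<close>

text \<open>
  The product of all commutative rings carried by \<open>'a\<close> is a type of class \<open>comm_ring_1\<close> projecting
  onto each of them, so matrices lift to it and identities between type-class determinants descend
  to \<open>ring_det\<close>. The extra factor \<open>int\<close> ensures \<open>0 \<noteq> 1\<close>, which can fail when \<open>'a\<close> has one element.
\<close>

typedef 'a cring_tuple =
  "{f :: 'a ring \<Rightarrow> 'a. \<forall>R. if cring R then f R \<in> carrier R else f R = undefined} \<times> (UNIV :: int set)"
proof -
  have "(\<lambda>R. if cring R then \<zero>\<^bsub>R\<^esub> else undefined) \<in>
      {f :: 'a ring \<Rightarrow> 'a. \<forall>R. if cring R then f R \<in> carrier R else f R = undefined}"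
    by (auto simp: cring.cring_simprules)
  then show ?thesis by (intro exI[of _ "(_, 0)"]) auto
qed

setup_lifting type_definition_cring_tuple

lift_definition proj :: "'a ring \<Rightarrow> 'a cring_tuple \<Rightarrow> 'a" is "\<lambda>R x. fst x R" .

lift_definition int_part :: "'a cring_tuple \<Rightarrow> int" is snd .

lemma proj_closed [simp]: "cring R \<Longrightarrow> proj R x \<in> carrier R"
  using Rep_cring_tuple[of x] unfolding proj.rep_eq mem_Times_iff mem_Collect_eq by presburger

text \<open>Structures that are not commutative rings carry the fixed value
  \<open>undefined\<close>, so elements can differ only at a commutative ring or in the integer
  part. This reduces the class axioms to componentwise checks.\<close>

lemma cring_tuple_eqI:
  fixes x y :: "'a cring_tuple"
  assumes "\<And>R :: 'a ring. cring R \<Longrightarrow> proj R x = proj R y" "int_part x = int_part y"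
  shows "x = y"
proof -
  have undef: "fst (Rep_cring_tuple z) R = undefined" if "\<not> cring R" for z and R :: "'a ring"
    using Rep_cring_tuple[of z] that unfolding mem_Times_iff mem_Collect_eq by presburger
  have "fst (Rep_cring_tuple x) R = fst (Rep_cring_tuple y) R" for R
    using assms(1)[of R] undef[of R] by (cases "cring R") (simp_all add: proj.rep_eq)
  then show ?thesis
    using assms(2) by (simp add: int_part.rep_eq prod_eq_iff fun_eq_iff flip: Rep_cring_tuple_inject)
qed

instantiation cring_tuple :: (type) comm_ring_1
begin

lift_definition zero_cring_tuple :: "'a cring_tuple"
  is "(\<lambda>R. if cring R then \<zero>\<^bsub>R\<^esub> else undefined, 0)"
  by (simp add: cring.cring_simprules(1-6))

lift_definition one_cring_tuple :: "'a cring_tuple"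
  is "(\<lambda>R. if cring R then \<one>\<^bsub>R\<^esub> else undefined, 1)"
  by (simp add: cring.cring_simprules(1-6))

lift_definition plus_cring_tuple :: "'a cring_tuple \<Rightarrow> 'a cring_tuple \<Rightarrow> 'a cring_tuple"
  is "\<lambda>x y. (\<lambda>R. if cring R then fst x R \<oplus>\<^bsub>R\<^esub> fst y R else undefined, snd x + snd y)"
  by (simp add: mem_Times_iff cring.cring_simprules(1-6))

lift_definition times_cring_tuple :: "'a cring_tuple \<Rightarrow> 'a cring_tuple \<Rightarrow> 'a cring_tuple"
  is "\<lambda>x y. (\<lambda>R. if cring R then fst x R \<otimes>\<^bsub>R\<^esub> fst y R else undefined, snd x * snd y)"
  by (simp add: mem_Times_iff cring.cring_simprules(1-6))

lift_definition uminus_cring_tuple :: "'a cring_tuple \<Rightarrow> 'a cring_tuple"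
  is "\<lambda>x. (\<lambda>R. if cring R then \<ominus>\<^bsub>R\<^esub> fst x R else undefined, - snd x)"
  by (simp add: mem_Times_iff cring.cring_simprules(1-6))

lift_definition minus_cring_tuple :: "'a cring_tuple \<Rightarrow> 'a cring_tuple \<Rightarrow> 'a cring_tuple"
  is "\<lambda>x y. (\<lambda>R. if cring R then fst x R \<ominus>\<^bsub>R\<^esub> fst y R else undefined, snd x - snd y)"
  by (simp add: mem_Times_iff cring.cring_simprules(1-6))

lemma
  fixes R :: "'a ring"
  assumes "cring R"
  shows proj_zero [simp]: "proj R 0 = \<zero>\<^bsub>R\<^esub>"
    and proj_one [simp]: "proj R 1 = \<one>\<^bsub>R\<^esub>"
    and proj_add [simp]: "proj R (x + y) = proj R x \<oplus>\<^bsub>R\<^esub> proj R y"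
    and proj_mult [simp]: "proj R (x * y) = proj R x \<otimes>\<^bsub>R\<^esub> proj R y"
    and proj_uminus [simp]: "proj R (- x) = \<ominus>\<^bsub>R\<^esub> proj R x"
    and proj_diff [simp]: "proj R (x - y) = proj R x \<ominus>\<^bsub>R\<^esub> proj R y"
  using assms by (transfer; simp)+

lemma int_part_simps [simp]:
  "int_part 0 = 0" "int_part 1 = 1"
  "int_part (x + y) = int_part x + int_part y"
  "int_part (x * y) = int_part x * int_part y"
  "int_part (- x) = - int_part x"
  "int_part (x - y) = int_part x - int_part y"
  by (transfer; simp)+

instance
proof
  fix x y z :: "'a cring_tuple"
  show "x + y + z = x + (y + z)"
    by (rule cring_tuple_eqI) (simp_all add: cring.cring_simprules(7))
  show "x + y = y + x"
    by (rule cring_tuple_eqI) (simp_all add: cring.cring_simprules(10))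
  show "0 + x = x"
    by (rule cring_tuple_eqI) (simp_all add: cring.cring_simprules)
  show "- x + x = 0"
    by (rule cring_tuple_eqI) (simp_all add: cring.cring_simprules)
  show "x - y = x + - y"
    by (rule cring_tuple_eqI) (simp_all add: a_minus_def)
  show "x * y * z = x * (y * z)"
    by (rule cring_tuple_eqI) (simp_all add: cring.cring_simprules(11))
  show "x * y = y * x"
    by (rule cring_tuple_eqI) (simp_all add: cring.cring_simprules(14))
  show "1 * x = x"
    by (rule cring_tuple_eqI) (simp_all add: cring.cring_simprules(12))
  show "(x + y) * z = x * z + y * z"
    by (rule cring_tuple_eqI) (simp_all add: cring.cring_simprules(13) distrib_right)
  show "(0 :: 'a cring_tuple) \<noteq> 1"
    using int_part_simps(1,2) by (metis zero_neq_one)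
qed

end

text \<open>An element of the product may be prescribed at \<open>R\<close> alone, with zero at
  every other commutative ring. A single section \<open>s\<close> serves all elements of the
  carrier.\<close>

lemma proj_section:
  fixes R :: "'a ring"
  assumes "cring R"
  obtains s where "\<And>a. a \<in> carrier R \<Longrightarrow> proj R (s a) = a"
proof
  fix a assume a: "a \<in> carrier R"
  define f where "f = (\<lambda>S :: 'a ring. if S = R then a else if cring S then \<zero>\<^bsub>S\<^esub> else undefined)"
  have "\<forall>S. if cring S then f S \<in> carrier S else f S = undefined"
    using assms a by (auto simp: f_def cring.cring_simprules)
  then have "proj R (Abs_cring_tuple (f, 0)) = f R"
    by (simp add: proj.rep_eq Abs_cring_tuple_inverse)
  then have "\<exists>x. proj R x = a"
    by (auto simp: f_def)
  then show "proj R (SOME x. proj R x = a) = a"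
    by (rule someI_ex)
qed

section \<open>Projections of finite sums, products and determinants\<close>

lemma proj_sum:
  assumes "cring R" "finite I"
  shows "proj R (\<Sum>i\<in>I. f i) = (\<Oplus>\<^bsub>R\<^esub>i\<in>I. proj R (f i))"
proof -
  interpret cring R by fact
  show ?thesis
    using assms(2) by (induction I rule: finite_induct) (use assms(1) in \<open>auto simp: Pi_def\<close>)
qed

lemma proj_prod:
  assumes "cring R" "finite I"
  shows "proj R (\<Prod>i\<in>I. f i) = (\<Otimes>\<^bsub>R\<^esub>i\<in>I. proj R (f i))"
proof -
  interpret cring R by fact
  show ?thesis
    using assms(2) by (induction I rule: finite_induct) (use assms(1) in \<open>auto simp: Pi_def\<close>)
qed

lemma proj_det:
  assumes "cring R" and M: "M \<in> carrier_mat n n"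
  shows "proj R (det M) = ring_det R (map_mat (proj R) M)"
proof -
  interpret cring R by fact
  have "proj R (signof p * (\<Prod>i = 0..<n. M $$ (i, p i))) =
      (if evenperm p then \<one>\<^bsub>R\<^esub> else \<ominus>\<^bsub>R\<^esub> \<one>\<^bsub>R\<^esub>) \<otimes>\<^bsub>R\<^esub>
        (\<Otimes>\<^bsub>R\<^esub>i\<in>{0..<n}. map_mat (proj R) M $$ (i, p i))"
    if p: "p permutes {0..<n}" for p
  proof -
    have "p i < n" if "i < n" for i
      using permutes_in_image[OF p, of i] that by simp
    then have "(\<Otimes>\<^bsub>R\<^esub>i\<in>{0..<n}. map_mat (proj R) M $$ (i, p i)) = (\<Otimes>\<^bsub>R\<^esub>i\<in>{0..<n}. proj R (M $$ (i, p i)))"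
      using M assms(1) by (intro finprod_cong') auto
    then show ?thesis
      using assms(1) by (simp add: proj_prod sign_def)
  qed
  moreover have "proj R (signof p * (\<Prod>i = 0..<n. M $$ (i, p i))) \<in> carrier R" for p
    using assms(1) by (rule proj_closed)
  ultimately have "(\<Oplus>\<^bsub>R\<^esub>p\<in>{p. p permutes {0..<n}}. proj R (signof p * (\<Prod>i = 0..<n. M $$ (i, p i)))) =
     (\<Oplus>\<^bsub>R\<^esub>p\<in>{p. p permutes {0..<n}}. (if evenperm p then \<one>\<^bsub>R\<^esub> else \<ominus>\<^bsub>R\<^esub> \<one>\<^bsub>R\<^esub>) \<otimes>\<^bsub>R\<^esub>
        (\<Otimes>\<^bsub>R\<^esub>i\<in>{0..<n}. map_mat (proj R) M $$ (i, p i)))"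
    by (intro finsum_cong') (simp_all only: mem_Collect_eq Pi_iff simp_thms refl ball_simps, metis+)
  then show ?thesis
    using M assms(1) by (simp add: det_def' proj_sum finite_permutations ring_det_def)
qed

lemma map_mat_proj_surj:
  assumes "cring R" "M \<in> carrier_mat n m" "elements_mat M \<subseteq> carrier R"
  obtains L where "L \<in> carrier_mat n m" "map_mat (proj R) L = M"
proof -
  obtain s where s: "\<And>a. a \<in> carrier R \<Longrightarrow> proj R (s a) = a"
    using proj_section[OF assms(1)] by blast
  have "map_mat (proj R) (map_mat s M) = M"
    using assms(3) by (intro eq_matI) (auto intro!: s)
  then show thesis
    using assms(2) by (intro that[of "map_mat s M"]) auto
qed

section \<open>Cofactors and Laplace expansion for \<open>ring_det\<close>\<close>

definition ring_cofactor :: "'a ring \<Rightarrow> 'a mat \<Rightarrow> nat \<Rightarrow> nat \<Rightarrow> 'a" where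
  "ring_cofactor R M i j =
     (if even (i + j) then \<one>\<^bsub>R\<^esub> else \<ominus>\<^bsub>R\<^esub> \<one>\<^bsub>R\<^esub>) \<otimes>\<^bsub>R\<^esub> ring_det R (mat_delete M i j)"

lemma proj_cofactor:
  assumes "cring R" and M: "M \<in> carrier_mat n n" and "i < n" "j < n"
  shows "proj R (cofactor M i j) = ring_cofactor R (map_mat (proj R) M) i j"
proof -
  have "map_mat (proj R) (mat_delete M i j) = mat_delete (map_mat (proj R) M) i j"
    using assms by (intro eq_matI) (auto simp: mat_delete_def)
  moreover have "mat_delete M i j \<in> carrier_mat (n - 1) (n - 1)"
    using M by (rule mat_delete_carrier)
  moreover have "proj R ((- 1) ^ (i + j)) = (if even (i + j) then \<one>\<^bsub>R\<^esub> else \<ominus>\<^bsub>R\<^esub> \<one>\<^bsub>R\<^esub>)"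
    using assms(1) by (cases "even (i + j)") (simp_all only: neg_one_even_power neg_one_odd_power minus_one_power_iff proj_one proj_uminus if_True if_False)
  ultimately show ?thesis
    using assms(1) by (simp only: cofactor_def ring_cofactor_def proj_mult proj_det)
qed

context
  fixes R :: "'a ring" and M :: "'a mat" and n :: nat
  assumes R: "cring R" and M: "M \<in> carrier_mat n n" "elements_mat M \<subseteq> carrier R"
begin

lemma ring_det_closed: "ring_det R M \<in> carrier R"
proof -
  obtain L where L: "L \<in> carrier_mat n n" "map_mat (proj R) L = M"
    using map_mat_proj_surj[OF R M] by blast
  show ?thesis
    using proj_closed[OF R, of "det L"] proj_det[OF R L(1)] L(2) by simp
qed

lemma ring_det_identical_rows:
  assumes "i \<noteq> i'" "i < n" "i' < n" "\<And>j. j < n \<Longrightarrow> M $$ (i, j) = M $$ (i', j)"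
  shows "ring_det R M = \<zero>\<^bsub>R\<^esub>"
proof -
  \<comment> \<open>One section applied to all entries lifts equal entries to equal entries, so the
    two rows still coincide after lifting. An arbitrary lift of \<open>M\<close> need not preserve
    this.\<close>
  obtain s where s: "\<And>a. a \<in> carrier R \<Longrightarrow> proj R (s a) = a"
    using proj_section[OF R] by blast
  have "map_mat (proj R) (map_mat s M) = M"
    using M by (intro eq_matI) (auto intro!: s)
  moreover have "det (map_mat s M) = 0"
    using M assms by (intro det_identical_rows[of _ n i i']) (auto intro!: eq_vecI)
  ultimately show ?thesis
    using R M proj_det[OF R, of "map_mat s M" n] by simp
qed

lemma ring_laplace_row:
  assumes "i < n"
  shows "ring_det R M = (\<Oplus>\<^bsub>R\<^esub>j\<in>{..<n}. M $$ (i, j) \<otimes>\<^bsub>R\<^esub> ring_cofactor R M i j)"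
proof -
  interpret cring R by fact
  obtain L where L: "L \<in> carrier_mat n n" "map_mat (proj R) L = M"
    using map_mat_proj_surj[OF R M] by blast
  have "ring_det R M = (\<Oplus>\<^bsub>R\<^esub>j\<in>{..<n}. proj R (L $$ (i, j) * cofactor L i j))"
    using proj_det[OF R L(1)] L R laplace_expansion_row[OF L(1) assms] by (simp add: proj_sum)
  also have "\<dots> = (\<Oplus>\<^bsub>R\<^esub>j\<in>{..<n}. M $$ (i, j) \<otimes>\<^bsub>R\<^esub> ring_cofactor R M i j)"
    using L R assms proj_cofactor[OF R L(1)]
    by (intro finsum_cong') (auto intro!: m_closed simp flip: L(2) proj_cofactor[OF R L(1)])
  finally show ?thesis .
qed

lemma ring_laplace_column:
  assumes "j < n"
  shows "ring_det R M = (\<Oplus>\<^bsub>R\<^esub>i\<in>{..<n}. M $$ (i, j) \<otimes>\<^bsub>R\<^esub> ring_cofactor R M i j)"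
proof -
  interpret cring R by fact
  obtain L where L: "L \<in> carrier_mat n n" "map_mat (proj R) L = M"
    using map_mat_proj_surj[OF R M] by blast
  have "ring_det R M = (\<Oplus>\<^bsub>R\<^esub>i\<in>{..<n}. proj R (L $$ (i, j) * cofactor L i j))"
    using proj_det[OF R L(1)] L R laplace_expansion_column[OF L(1) assms] by (simp add: proj_sum)
  also have "\<dots> = (\<Oplus>\<^bsub>R\<^esub>i\<in>{..<n}. M $$ (i, j) \<otimes>\<^bsub>R\<^esub> ring_cofactor R M i j)"
    using L R assms proj_cofactor[OF R L(1)]
    by (intro finsum_cong') (auto intro!: m_closed simp flip: L(2) proj_cofactor[OF R L(1)])
  finally show ?thesis .
qed

end

section \<open>Linear forms over a finite field\<close>

definition dot :: "('a, 'b) ring_scheme \<Rightarrow> nat \<Rightarrow> (nat \<Rightarrow> 'a) \<Rightarrow> (nat \<Rightarrow> 'a) \<Rightarrow> 'a" where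
  "dot R d y w = (\<Oplus>\<^bsub>R\<^esub>j\<in>{..<d}. y j \<otimes>\<^bsub>R\<^esub> w j)"

context field
begin

lemma dot_closed [simp]:
  assumes "\<And>j. j < d \<Longrightarrow> y j \<in> carrier R" "\<And>j. j < d \<Longrightarrow> w j \<in> carrier R"
  shows "dot R d y w \<in> carrier R"
  using assms by (auto simp: dot_def intro!: finsum_closed)

lemma dot_cong:
  assumes "\<And>j. j < d \<Longrightarrow> y j = y' j" "\<And>j. j < d \<Longrightarrow> w j = w' j"
    and "\<And>j. j < d \<Longrightarrow> y' j \<in> carrier R" "\<And>j. j < d \<Longrightarrow> w' j \<in> carrier R"
  shows "dot R d y w = dot R d y' w'"
  unfolding dot_def using assms by (intro finsum_cong') auto

lemma dot_diff_right:
  assumes "\<And>j. j < d \<Longrightarrow> y j \<in> carrier R" "\<And>j. j < d \<Longrightarrow> w j \<in> carrier R"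
    and "\<And>j. j < d \<Longrightarrow> w' j \<in> carrier R"
  shows "dot R d y (\<lambda>j. w j \<ominus> w' j) = dot R d y w \<ominus> dot R d y w'"
proof -
  have distr: "a \<otimes> (b \<ominus> c) \<oplus> a \<otimes> c = a \<otimes> b"
    and cancel: "a = (a \<oplus> b) \<ominus> b"
    if "a \<in> carrier R" "b \<in> carrier R" "c \<in> carrier R" for a b c
    using that by algebra+
  have "dot R d y (\<lambda>j. w j \<ominus> w' j) \<oplus> dot R d y w' =
      (\<Oplus>j\<in>{..<d}. y j \<otimes> (w j \<ominus> w' j) \<oplus> y j \<otimes> w' j)"
    unfolding dot_def using assms by (subst finsum_addf) auto
  also have "\<dots> = dot R d y w"
    unfolding dot_def using assms by (intro finsum_cong') (auto simp: distr)
  finally have eq: "dot R d y (\<lambda>j. w j \<ominus> w' j) \<oplus> dot R d y w' = dot R d y w" .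
  have "dot R d y (\<lambda>j. w j \<ominus> w' j) \<in> carrier R" "dot R d y w' \<in> carrier R"
    using assms by auto
  then show ?thesis
    unfolding eq[symmetric] using cancel by blast
qed

text \<open>The scaled vector is restricted to \<open>{..<d}\<close> so that it remains an
  extensional function and can be a member of the space of all vectors.\<close>

lemma dot_smult_left:
  assumes "s \<in> carrier R" "\<And>j. j < d \<Longrightarrow> y j \<in> carrier R" "\<And>j. j < d \<Longrightarrow> w j \<in> carrier R"
  shows "dot R d (\<lambda>j\<in>{..<d}. s \<otimes> y j) w = s \<otimes> dot R d y w"
proof -
  have "dot R d (\<lambda>j\<in>{..<d}. s \<otimes> y j) w = (\<Oplus>j\<in>{..<d}. s \<otimes> (y j \<otimes> w j))"
    unfolding dot_def using assms by (intro finsum_cong') (auto simp: m_assoc)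
  also have "\<dots> = s \<otimes> dot R d y w"
    unfolding dot_def using assms by (subst finsum_rdistr) auto
  finally show ?thesis .
qed

lemma dot_split:
  assumes "k < d" "\<And>j. j < d \<Longrightarrow> y j \<in> carrier R" "\<And>j. j < d \<Longrightarrow> w j \<in> carrier R"
  shows "dot R d y w = y k \<otimes> w k \<oplus> (\<Oplus>j\<in>{..<d} - {k}. y j \<otimes> w j)"
proof -
  have "{..<d} = insert k ({..<d} - {k})"
    using assms(1) by auto
  then have "dot R d y w = (\<Oplus>j\<in>insert k ({..<d} - {k}). y j \<otimes> w j)"
    by (simp add: dot_def)
  also have "\<dots> = y k \<otimes> w k \<oplus> (\<Oplus>j\<in>{..<d} - {k}. y j \<otimes> w j)"
    using assms by (intro finsum_insert) auto
  finally show ?thesis .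
qed

text \<open>The terms other than \<open>k\<close> form the same sum on both sides and cancel, and
  then the nonzero factor \<open>w k\<close> cancels. This serves both to count points on
  hyperplanes and to recover a matrix column from a vector orthogonal to the rows.\<close>

lemma dot_eq_imp_component_eq:
  assumes "dot R d c w = dot R d c' w"
    and c: "\<And>j. j < d \<Longrightarrow> c j \<in> carrier R" and c': "\<And>j. j < d \<Longrightarrow> c' j \<in> carrier R"
    and w: "\<And>j. j < d \<Longrightarrow> w j \<in> carrier R"
    and k: "k < d" "w k \<noteq> \<zero>" and eq: "\<And>j. j < d \<Longrightarrow> j \<noteq> k \<Longrightarrow> c j = c' j"
  shows "c k = c' k"
proof -
  have "(\<Oplus>j\<in>{..<d} - {k}. c j \<otimes> w j) = (\<Oplus>j\<in>{..<d} - {k}. c' j \<otimes> w j)"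
    using c c' w eq by (intro finsum_cong') auto
  moreover have "(\<Oplus>j\<in>{..<d} - {k}. c' j \<otimes> w j) \<in> carrier R"
    using c' w by (auto intro!: finsum_closed)
  ultimately have "c k \<otimes> w k = c' k \<otimes> w k"
    using assms(1) c c' w k(1) by (simp add: dot_split[OF k(1)])
  then show ?thesis
    using m_rcancel[of "w k" "c k" "c' k"] c c' w k by simp
qed

text \<open>Some coefficient \<open>g k\<close> is nonzero, so coordinate \<open>k\<close> of a
  solution is determined by the other \<open>d - 1\<close> coordinates.\<close>

lemma card_hyperplane_le:
  assumes B: "finite B" "B \<subseteq> carrier R"
    and g: "\<And>j. j < d \<Longrightarrow> g j \<in> carrier R" and k: "k < d" "g k \<noteq> \<zero>"
  shows "card {c \<in> {..<d} \<rightarrow>\<^sub>E B. dot R d c g = \<zero>} \<le> card B ^ (d - 1)"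
proof -
  let ?H = "{c \<in> {..<d} \<rightarrow>\<^sub>E B. dot R d c g = \<zero>}" and ?J = "{..<d} - {k}"
  have mem: "c j \<in> B" if "c \<in> ?H" "j < d" for c j
    using that PiE_mem[of c "{..<d}" "\<lambda>_. B" j] by blast
  have "inj_on (\<lambda>c. restrict c ?J) ?H"
  proof (rule inj_onI)
    fix c c' assume c: "c \<in> ?H" and c': "c' \<in> ?H" and eq: "restrict c ?J = restrict c' ?J"
    have eq': "c j = c' j" if "j < d" "j \<noteq> k" for j
      using fun_cong[OF eq, of j] that by (simp add: restrict_def)
    have "c k = c' k"
      by (rule dot_eq_imp_component_eq[of d c g c'])
        (use c c' mem B(2) g k eq' in \<open>simp_all add: subset_iff\<close>)
    then show "c = c'"
      using c c' eq' by (intro PiE_ext[of c "{..<d}" "\<lambda>_. B" c']) auto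
  qed
  moreover have "(\<lambda>c. restrict c ?J) ` ?H \<subseteq> ?J \<rightarrow>\<^sub>E B"
    using mem by (intro image_subsetI) (simp only: restrict_PiE_iff, simp)
  moreover have "finite (?J \<rightarrow>\<^sub>E B)"
    using B by (intro finite_PiE) auto
  ultimately have "card ?H \<le> card (?J \<rightarrow>\<^sub>E B)"
    by (rule card_inj_on_le)
  also have "\<dots> = card B ^ (d - 1)"
    using k by (simp add: card_PiE)
  finally show ?thesis .
qed

end

section \<open>Second moments and the values of linear forms\<close>

lemma sum_card_fibre_squared:
  assumes "finite S" "finite T" "g ` S \<subseteq> T"
  shows "(\<Sum>t\<in>T. (real (card {x\<in>S. g x = t}))\<^sup>2) = card {(x, x') \<in> S \<times> S. g x = g x'}"
proof -
  have "(\<Sum>t\<in>T. (real (card {x\<in>S. g x = t}))\<^sup>2) = (\<Sum>x\<in>S. real (card {x'\<in>S. g x' = g x}))"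
    using sum_fun_comp[OF assms, of "\<lambda>t. real (card {x\<in>S. g x = t})"] by (simp add: power2_eq_square)
  also have "\<dots> = card (SIGMA x:S. {x'\<in>S. g x' = g x})"
    using assms by simp
  also have "(SIGMA x:S. {x'\<in>S. g x' = g x}) = {(x, x') \<in> S \<times> S. g x = g x'}"
    by auto
  finally show ?thesis .
qed

text \<open>This is the variance identity: \<open>W / card V\<close> is the mean of \<open>f\<close>
  over \<open>V\<close>.\<close>

lemma sum_deviation_squared:
  fixes f :: "'b \<Rightarrow> real"
  assumes "finite V" "V \<noteq> {}" "(\<Sum>l\<in>V. f l) = W"
  shows "(\<Sum>l\<in>V. (f l - W / card V)\<^sup>2) = (\<Sum>l\<in>V. (f l)\<^sup>2) - W\<^sup>2 / card V"
proof -
  have q: "real (card V) \<noteq> 0"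
    using assms by simp
  have "(\<Sum>l\<in>V. (f l - c)\<^sup>2) = (\<Sum>l\<in>V. (f l)\<^sup>2) - 2 * c * (\<Sum>l\<in>V. f l) + card V * c\<^sup>2" for c :: real
  proof -
    have "(\<Sum>l\<in>V. (f l - c)\<^sup>2) = (\<Sum>l\<in>V. (f l)\<^sup>2 - 2 * c * f l + c\<^sup>2)"
      by (simp add: power2_diff algebra_simps)
    then show ?thesis
      by (simp add: sum.distrib sum_subtractf flip: sum_distrib_left)
  qed
  then have "(\<Sum>l\<in>V. (f l - W / card V)\<^sup>2) =
      (\<Sum>l\<in>V. (f l)\<^sup>2) - 2 * (W / card V) * (\<Sum>l\<in>V. f l) + card V * (W / card V)\<^sup>2" .
  also have "\<dots> = (\<Sum>l\<in>V. (f l)\<^sup>2) - W\<^sup>2 / card V"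
    using q by (simp add: assms(3) power2_eq_square field_simps)
  finally show ?thesis .
qed


text \<open>In the application \<open>x\<close> is the first row of a matrix, \<open>X\<close> the
  block below it and \<open>u X\<close> its vector of signed minors. The first term of the bound
  comes from the mean, the second from the variance; \<open>E\<close> counts the pairs with equal
  vectors.\<close>

lemma (in field) sum_squares_dot_count_le:
  fixes \<Omega> :: "'x set" and u :: "'x \<Rightarrow> nat \<Rightarrow> 'a" and A :: "'a set" and d :: nat
  defines "a \<equiv> real (card A)" and "q \<equiv> real (card (carrier R))" and "W \<equiv> real (card \<Omega>)"
    and "P \<equiv> {..<d} \<rightarrow>\<^sub>E A"
    and "E \<equiv> real (card {(X, X') \<in> \<Omega> \<times> \<Omega>. \<forall>j<d. u X j = u X' j})"
  assumes fin: "finite (carrier R)" "finite \<Omega>" and A: "A \<subseteq> carrier R" and d: "d \<ge> 1"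
    and u: "\<And>X j. X \<in> \<Omega> \<Longrightarrow> j < d \<Longrightarrow> u X j \<in> carrier R"
  shows "(\<Sum>l\<in>carrier R - {\<zero>}. (real (card {(x, X) \<in> P \<times> \<Omega>. dot R d x (u X) = l}))\<^sup>2)
           \<le> (a ^ d * W)\<^sup>2 / q + a ^ (d + 1) * q ^ (d - 1) * E"
proof -
  \<comment> \<open>\<open>D y\<close> is the squared deviation of \<open>F y\<close> from its mean
    \<open>W / q\<close>, summed over the field.\<close>
  define F where "F y l = real (card {X\<in>\<Omega>. dot R d y (u X) = l})" for y l
  define D where "D y = (\<Sum>l\<in>carrier R. (F y l - W / q)\<^sup>2)" for y
  define Y where "Y = {..<d} \<rightarrow>\<^sub>E carrier R"
  define orig where "orig = (\<lambda>j\<in>{..<d}. \<zero>)"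
  define sc where "sc s y = (\<lambda>j\<in>{..<d}. s \<otimes> y j)" for s y
  have finA: "finite A"
    using A fin(1) by (rule finite_subset)
  have finP: "finite P" and finY: "finite Y"
    using finA fin by (auto simp: P_def Y_def intro!: finite_PiE)
  have PY: "P \<subseteq> Y"
    unfolding P_def Y_def using A by (rule PiE_mono)
  have card_P: "real (card P) = a ^ d" and card_Y: "real (card Y) = q ^ d"
    by (simp_all add: P_def Y_def card_PiE a_def q_def)
  have "card {\<zero>, \<one>} \<le> card (carrier R)"
    using fin by (intro card_mono) auto
  then have q2: "q \<ge> 2"
    by (simp add: q_def)
  have Y: "y j \<in> carrier R" if "y \<in> Y" "j < d" for y j
    using that by (auto simp: Y_def)
  have dot_carrier: "dot R d y (u X) \<in> carrier R" if "y \<in> Y" "X \<in> \<Omega>" for y X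
    using that Y u by auto
  have sum_F: "(\<Sum>l\<in>carrier R. F y l) = W" if "y \<in> Y" for y
  proof -
    have "(\<lambda>X. dot R d y (u X)) ` \<Omega> \<subseteq> carrier R"
      using dot_carrier[OF that] by auto
    from sum_fun_comp[OF fin(2,1) this, of "\<lambda>_. 1 :: real"] show ?thesis
      by (simp add: F_def W_def)
  qed
  have D_eq: "D y = (\<Sum>l\<in>carrier R. (F y l)\<^sup>2) - W\<^sup>2 / q" if "y \<in> Y" for y
    using sum_deviation_squared[OF fin(1) _ sum_F[OF that]] carrier_not_empty by (simp add: D_def q_def)
  have D_nonneg: "D y \<ge> 0" for y
    by (simp add: D_def sum_nonneg)

  \<comment> \<open>A pair with equal vectors agrees on all \<open>q ^ d\<close> choices of
    \<open>y\<close>; any other pair agrees only for \<open>y\<close> orthogonal to a nonzero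
    difference, hence for at most \<open>q ^ (d - 1)\<close> choices. The resulting term
    \<open>q ^ (d - 1) * W\<^sup>2\<close> is exactly cancelled by the subtracted means.\<close>
  have sum_D: "(\<Sum>y\<in>Y. D y) \<le> q ^ (d - 1) * (q - 1) * E"
  proof -
    let ?Q = "\<Omega> \<times> \<Omega>" and ?eq = "\<lambda>z. \<forall>j<d. u (fst z) j = u (snd z) j"
    let ?c = "\<lambda>z. real (card {y\<in>Y. dot R d y (u (fst z)) = dot R d y (u (snd z))})"
    have E_eq: "E = card {z\<in>?Q. ?eq z}"
      unfolding E_def by (rule arg_cong[of _ _ "\<lambda>S. real (card S)"]) auto
    have "(\<Sum>y\<in>Y. \<Sum>l\<in>carrier R. (F y l)\<^sup>2) =
        (\<Sum>y\<in>Y. real (card {z\<in>?Q. dot R d y (u (fst z)) = dot R d y (u (snd z))}))"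
    proof (rule sum.cong[OF refl])
      fix y assume y: "y \<in> Y"
      have "(\<Sum>l\<in>carrier R. (F y l)\<^sup>2) = card {(X, X') \<in> ?Q. dot R d y (u X) = dot R d y (u X')}"
        unfolding F_def using dot_carrier[OF y] by (intro sum_card_fibre_squared fin) auto
      also have "{(X, X') \<in> ?Q. dot R d y (u X) = dot R d y (u X')} =
          {z\<in>?Q. dot R d y (u (fst z)) = dot R d y (u (snd z))}"
        by auto
      finally show "(\<Sum>l\<in>carrier R. (F y l)\<^sup>2) = real (card \<dots>)" .
    qed
    also have "\<dots> = (\<Sum>z\<in>?Q. ?c z)"
      using sum_multicount_gen[of Y ?Q "\<lambda>y z. dot R d y (u (fst z)) = dot R d y (u (snd z))"
          "\<lambda>z. card {y\<in>Y. dot R d y (u (fst z)) = dot R d y (u (snd z))}"] finY fin(2)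
      by (simp flip: of_nat_sum)
    also have "\<dots> \<le> (\<Sum>z\<in>?Q. if ?eq z then q ^ d else q ^ (d - 1))"
    proof (rule sum_mono)
      fix z assume "z \<in> ?Q"
      then obtain X X' where z: "z = (X, X')" "X \<in> \<Omega>" "X' \<in> \<Omega>"
        by auto
      show "?c z \<le> (if ?eq z then q ^ d else q ^ (d - 1))"
      proof (cases "?eq z")
        case True
        have "card {y\<in>Y. dot R d y (u (fst z)) = dot R d y (u (snd z))} \<le> card Y"
          using finY by (intro card_mono) auto
        then show ?thesis
          using True card_Y by (simp flip: card_Y)
      next
        case False
        then obtain k where k: "k < d" "u X k \<noteq> u X' k"
          using z by auto
        let ?g = "\<lambda>j. u X j \<ominus> u X' j"
        have "dot R d y (u X) = dot R d y (u X') \<longleftrightarrow> dot R d y ?g = \<zero>" if y: "y \<in> Y" for y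
        proof -
          have "dot R d y ?g = dot R d y (u X) \<ominus> dot R d y (u X')"
            using Y[OF y] u z by (intro dot_diff_right) auto
          then show ?thesis
            using dot_carrier[OF y] z by (simp only: r_right_minus_eq)
        qed
        then have "{y\<in>Y. dot R d y (u (fst z)) = dot R d y (u (snd z))} = {y\<in>Y. dot R d y ?g = \<zero>}"
          using z by auto
        also have "card \<dots> \<le> card (carrier R) ^ (d - 1)"
          unfolding Y_def using k u z fin by (intro card_hyperplane_le[of _ _ _ k]) auto
        finally show ?thesis
          unfolding if_not_P[OF False] q_def by (simp flip: of_nat_power)
      qed
    qed
    also have "\<dots> = (\<Sum>z\<in>?Q. q ^ (d - 1) + (if ?eq z then q ^ d - q ^ (d - 1) else 0))"
      by (rule sum.cong) auto
    also have "\<dots> = q ^ (d - 1) * W\<^sup>2 + (q ^ d - q ^ (d - 1)) * E"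
      using fin(2) by (simp add: sum.distrib E_eq W_def power2_eq_square card_cartesian_product
          sum.If_cases Int_def mult_ac)
    finally have "(\<Sum>y\<in>Y. \<Sum>l\<in>carrier R. (F y l)\<^sup>2) \<le> q ^ (d - 1) * W\<^sup>2 + (q ^ d - q ^ (d - 1)) * E" .
    moreover have qd: "q ^ d = q * q ^ (d - 1)"
      using d by (cases d) auto
    moreover have "(\<Sum>y\<in>Y. D y) = (\<Sum>y\<in>Y. \<Sum>l\<in>carrier R. (F y l)\<^sup>2) - q ^ (d - 1) * W\<^sup>2"
      using q2 by (simp add: D_eq sum_subtractf card_Y qd)
    ultimately show ?thesis
      by (simp add: algebra_simps)
  qed

  \<comment> \<open>Multiplication by \<open>s\<close> permutes the field and carries the
    distribution of values for \<open>y\<close> to that for \<open>sc s y\<close>, so the summands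
    of \<open>D\<close> are merely permuted.\<close>
  have D_scale: "D (sc s y) = D y" if s: "s \<in> carrier R - {\<zero>}" and y: "y \<in> Y" for s y
  proof -
    have bij: "bij_betw (\<lambda>l. s \<otimes> l) (carrier R) (carrier R)"
      using s field_Units by (intro bij_betwI[where g = "\<lambda>l. inv s \<otimes> l"]) (auto simp flip: m_assoc)
    have "F (sc s y) (s \<otimes> l) = F y l" if "l \<in> carrier R" for l
    proof -
      have "dot R d (sc s y) (u X) = s \<otimes> l \<longleftrightarrow> dot R d y (u X) = l" if "X \<in> \<Omega>" for X
        using s y that \<open>l \<in> carrier R\<close> Y u dot_carrier
        by (simp add: sc_def dot_smult_left m_lcancel)
      then show ?thesis
        unfolding F_def by (metis (mono_tags, lifting))
    qed
    then show ?thesis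
      unfolding D_def by (subst sum.reindex_bij_betw[OF bij, symmetric]) simp
  qed

  \<comment> \<open>By scale invariance of \<open>D\<close>, averaging over the multiples of \<open>x\<close> spreads the sum over all of
    \<open>Y\<close>; a vector \<open>y\<close> is hit at most \<open>a\<close> times, as one nonzero entry of \<open>x \<in> P\<close> determines \<open>s\<close> and \<open>x\<close>.\<close>
  have sum_D_P: "(q - 1) * (\<Sum>x\<in>P - {orig}. D x) \<le> a * (\<Sum>y\<in>Y. D y)"
  proof -
    let ?S = "(carrier R - {\<zero>}) \<times> (P - {orig})"
    have sc_Y: "sc s y \<in> Y" if "s \<in> carrier R" "y \<in> Y" for s y
      using that by (auto simp: sc_def Y_def)
    have "(q - 1) * (\<Sum>x\<in>P - {orig}. D x) = (\<Sum>s\<in>carrier R - {\<zero>}. \<Sum>x\<in>P - {orig}. D x)"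
      using fin q2 by (simp add: card_Diff_singleton q_def of_nat_diff)
    also have "\<dots> = (\<Sum>(s, x)\<in>?S. D (sc s x))"
      unfolding sum.cartesian_product using D_scale PY by (intro sum.cong) auto
    also have "\<dots> = (\<Sum>z\<in>?S. D (case_prod sc z))"
      by (simp add: split_def)
    also have "\<dots> = (\<Sum>y\<in>Y. real (card {z\<in>?S. case_prod sc z = y}) * D y)"
      using fin finP finY PY sc_Y by (intro sum_fun_comp) auto
    also have "\<dots> \<le> (\<Sum>y\<in>Y. a * D y)"
    proof (intro sum_mono mult_right_mono D_nonneg)
      fix y assume "y \<in> Y"
      let ?Z = "{z\<in>?S. case_prod sc z = y}"
      show "real (card ?Z) \<le> a"
      proof (cases "?Z = {}")
        case False
        then obtain s x where sx: "s \<in> carrier R - {\<zero>}" "x \<in> P" "x \<noteq> orig" "sc s x = y"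
          by auto
        have "\<exists>k<d. x k \<noteq> \<zero>"
        proof (rule ccontr)
          assume "\<not> ?thesis"
          then have "x = orig"
            using sx(2) unfolding orig_def P_def by (intro extensionalityI[of _ "{..<d}"]) (auto simp: PiE_def)
          with sx(3) show False ..
        qed
        then obtain k where k: "k < d" "x k \<noteq> \<zero>"
          by auto
        \<comment> \<open>The index \<open>k\<close> comes from one member of the fibre but serves
          them all: since \<open>y k\<close> is nonzero, every member has a nonzero entry at
          \<open>k\<close>.\<close>
        have yk: "y k \<noteq> \<zero>"
          using k sx PY Y[of x k] by (auto simp: sc_def integral_iff)
        have "inj_on (\<lambda>z. snd z k) ?Z"
        proof (rule inj_onI)
          fix z z' assume "z \<in> ?Z" "z' \<in> ?Z" and eqk: "snd z k = snd z' k"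
          then obtain s x s' x' where z: "z = (s, x)" "s \<in> carrier R - {\<zero>}" "x \<in> P" "sc s x = y"
            and z': "z' = (s', x')" "s' \<in> carrier R - {\<zero>}" "x' \<in> P" "sc s' x' = y"
            by auto
          have x: "x j \<in> carrier R" "x' j \<in> carrier R" if "j < d" for j
            using z z' PY Y that by auto
          have eq: "s \<otimes> x j = s' \<otimes> x' j" if "j < d" for j
            using z(4) z'(4) that by (metis (no_types, lifting) sc_def lessThan_iff restrict_apply')
          have "y k = s \<otimes> x k"
            using z(4) k(1) by (auto simp: sc_def)
          then have "x k \<noteq> \<zero>"
            using yk z(2) by auto
          then have s: "s = s'"
            using eq[OF k(1)] eqk z z' x[OF k(1)] by (simp add: m_rcancel)
          have "x = x'"
          proof (rule PiE_ext)
            show "x \<in> {..<d} \<rightarrow>\<^sub>E A" "x' \<in> {..<d} \<rightarrow>\<^sub>E A"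
              using z z' by (auto simp: P_def)
            show "x j = x' j" if "j \<in> {..<d}" for j
              using eq[of j] s z(2) x[of j] that by (simp add: m_lcancel)
          qed
          with s show "z = z'"
            by (simp add: z z')
        qed
        moreover have "(\<lambda>z. snd z k) ` ?Z \<subseteq> A"
        proof (rule image_subsetI)
          fix z assume "z \<in> ?Z"
          then have "snd z \<in> P"
            by (simp add: mem_Times_iff)
          then show "snd z k \<in> A"
            using k(1) PiE_mem[of "snd z" "{..<d}" "\<lambda>_. A" k] unfolding P_def by simp
        qed
        ultimately have "card ?Z \<le> card A"
          using finA by (rule card_inj_on_le)
        then show ?thesis
          by (simp add: a_def)
      next
        case True
        then show ?thesis
          by (simp only: a_def card.empty of_nat_0 of_nat_0_le_iff)
      qed
    qed
    finally show ?thesis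
      by (simp add: sum_distrib_left)
  qed

  let ?B = "real (card (P - {orig}))"
  have B: "?B \<le> a ^ d"
    unfolding card_P[symmetric] using finP by (simp add: card_Diff1_le)
  have count: "real (card {(x, X) \<in> P \<times> \<Omega>. dot R d x (u X) = l}) = (\<Sum>x\<in>P - {orig}. F x l)"
    if l: "l \<in> carrier R - {\<zero>}" for l
  proof -
    have "dot R d orig (u X) = \<zero>" if "X \<in> \<Omega>" for X
    proof -
      have "dot R d orig (u X) = (\<Oplus>j\<in>{..<d}. \<zero>)"
        unfolding dot_def orig_def using u[OF that] by (intro finsum_cong') auto
      then show ?thesis
        by simp
    qed
    then have "{(x, X) \<in> P \<times> \<Omega>. dot R d x (u X) = l} =
        (SIGMA x:P - {orig}. {X\<in>\<Omega>. dot R d x (u X) = l})"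
      using l by auto
    then show ?thesis
      using finP fin by (simp add: F_def)
  qed
  have "(\<Sum>l\<in>carrier R - {\<zero>}. (real (card {(x, X) \<in> P \<times> \<Omega>. dot R d x (u X) = l}))\<^sup>2) =
      (\<Sum>l\<in>carrier R - {\<zero>}. (\<Sum>x\<in>P - {orig}. F x l)\<^sup>2)"
    by (intro sum.cong refl arg_cong[of _ _ "\<lambda>x. x\<^sup>2"] count)
  \<comment> \<open>Restoring \<open>l = \<zero>\<close> makes the sum run over the whole field,
    where the total and hence the mean are known.\<close>
  also have "\<dots> \<le> (\<Sum>l\<in>carrier R. (\<Sum>x\<in>P - {orig}. F x l)\<^sup>2)"
    using fin by (intro sum_mono2) auto
  also have "\<dots> = (\<Sum>l\<in>carrier R. ((\<Sum>x\<in>P - {orig}. F x l) - ?B * W / q)\<^sup>2) + (?B * W)\<^sup>2 / q"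
  proof -
    have "(\<Sum>l\<in>carrier R. \<Sum>x\<in>P - {orig}. F x l) = ?B * W"
      using sum_F PY by (subst sum.swap) (simp add: subset_iff)
    from sum_deviation_squared[OF fin(1) _ this] show ?thesis
      using carrier_not_empty by (simp add: q_def)
  qed
  \<comment> \<open>Cauchy-Schwarz over the \<open>?B\<close> nonzero vectors \<open>x\<close>,
    separately for each \<open>l\<close>.\<close>
  also have "(\<Sum>l\<in>carrier R. ((\<Sum>x\<in>P - {orig}. F x l) - ?B * W / q)\<^sup>2) \<le>
      (\<Sum>l\<in>carrier R. (\<Sum>x\<in>P - {orig}. (F x l - W / q)\<^sup>2) * ?B)"
  proof (rule sum_mono)
    fix l
    have "(\<Sum>x\<in>P - {orig}. F x l) - ?B * W / q = (\<Sum>x\<in>P - {orig}. F x l - W / q)"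
      by (simp add: sum_subtractf)
    then show "((\<Sum>x\<in>P - {orig}. F x l) - ?B * W / q)\<^sup>2 \<le> (\<Sum>x\<in>P - {orig}. (F x l - W / q)\<^sup>2) * ?B"
      using sum_squared_le_sum_of_squares[of "\<lambda>x. F x l - W / q" "P - {orig}"] by simp
  qed
  also have "\<dots> = ?B * (\<Sum>x\<in>P - {orig}. D x)"
    unfolding D_def by (subst sum.swap) (simp flip: sum_distrib_right)
  also have "\<dots> \<le> a ^ d * (a * (q ^ (d - 1) * E))"
  proof (intro mult_mono B)
    \<comment> \<open>The factor \<open>q - 1\<close> gained by averaging over nonzero scalars
      cancels the same factor in \<open>sum_D\<close>.\<close>
    have "(q - 1) * (\<Sum>x\<in>P - {orig}. D x) \<le> a * (q ^ (d - 1) * (q - 1) * E)"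
      using sum_D_P sum_D mult_left_mono[OF sum_D, of a] by (simp add: a_def)
    also have "\<dots> = (q - 1) * (a * (q ^ (d - 1) * E))"
      by simp
    finally show "(\<Sum>x\<in>P - {orig}. D x) \<le> a * (q ^ (d - 1) * E)"
      using q2 by (subst (asm) mult_le_cancel_left_pos) auto
  qed (auto simp: a_def sum_nonneg D_nonneg)
  also have "(?B * W)\<^sup>2 / q \<le> (a ^ d * W)\<^sup>2 / q"
    using B q2 by (intro divide_right_mono power_mono mult_right_mono) (auto simp: W_def)
  finally show ?thesis
    by (simp add: mult_ac)
qed

section \<open>Counting matrices\<close>

definition del_col :: "'a mat \<Rightarrow> nat \<Rightarrow> 'a mat" where
  "del_col X j = mat (dim_row X) (dim_col X - 1) (\<lambda>(i, k). X $$ (i, if k < j then k else Suc k))"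

definition cons_row :: "(nat \<Rightarrow> 'a) \<Rightarrow> 'a mat \<Rightarrow> 'a mat" where
  "cons_row x X = mat (Suc (dim_row X)) (dim_col X) (\<lambda>(i, j). if i = 0 then x j else X $$ (i - 1, j))"

text \<open>These are the cofactors along a row placed on top of \<open>X\<close>, whence the sign
  \<open>(-1) ^ j\<close>; the vector is the generalised cross product of the rows of
  \<open>X\<close>.\<close>

definition minor_vec :: "'a ring \<Rightarrow> 'a mat \<Rightarrow> nat \<Rightarrow> 'a" where
  "minor_vec R X j = (if even j then \<one>\<^bsub>R\<^esub> else \<ominus>\<^bsub>R\<^esub> \<one>\<^bsub>R\<^esub>) \<otimes>\<^bsub>R\<^esub> ring_det R (del_col X j)"

lemma del_col_carrier: "X \<in> carrier_mat n (Suc m) \<Longrightarrow> del_col X j \<in> carrier_mat n m"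
  by (auto simp: del_col_def)

lemma elements_mat_index:
  assumes "elements_mat X \<subseteq> B" "i < dim_row X" "j < dim_col X"
  shows "X $$ (i, j) \<in> B"
proof -
  have "X $$ (i, j) \<in> elements_mat X"
    using assms(2,3) by (auto simp: elements_mat_def intro!: bexI[of _ i])
  with assms(1) show ?thesis ..
qed

lemma elements_mat_subset_iff:
  assumes "X \<in> carrier_mat n m"
  shows "elements_mat X \<subseteq> B \<longleftrightarrow> (\<forall>i<n. \<forall>j<m. X $$ (i, j) \<in> B)"
proof
  assume "elements_mat X \<subseteq> B"
  from elements_mat_index[OF this] show "\<forall>i<n. \<forall>j<m. X $$ (i, j) \<in> B"
    using assms by simp
qed (use assms in \<open>auto simp: elements_mat_def\<close>)

lemma elements_del_col:
  assumes "X \<in> carrier_mat n (Suc m)" "elements_mat X \<subseteq> B"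
  shows "elements_mat (del_col X j) \<subseteq> B"
  unfolding elements_mat_subset_iff[OF del_col_carrier[OF assms(1)]]
  using assms elements_mat_index[OF assms(2)] by (auto simp: del_col_def)

lemma mat_eq_of_del_col_eq:
  assumes X: "X \<in> carrier_mat n (Suc m)" and Y: "Y \<in> carrier_mat n (Suc m)"
    and eq: "del_col X k = del_col Y k" and i: "i < n" and j: "j < Suc m" "j \<noteq> k" and k: "k < Suc m"
  shows "X $$ (i, j) = Y $$ (i, j)"
proof -
  let ?j = "if j < k then j else j - 1"
  have "del_col X k $$ (i, ?j) = X $$ (i, j)" "del_col Y k $$ (i, ?j) = Y $$ (i, j)"
    using X Y i j k by (auto simp: del_col_def)
  then show ?thesis
    using eq by simp
qed

text \<open>Columns \<open>j\<close> and \<open>n\<close> are removed in either order. Since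
  \<open>j < n\<close>, removing column \<open>j\<close> first moves the last column to position
  \<open>n - 1\<close>.\<close>

lemma mat_delete_del_col_last:
  assumes "X \<in> carrier_mat n (Suc n)" "i < n" "j < n"
  shows "mat_delete (del_col X n) i j = mat_delete (del_col X j) i (n - 1)"
  using assms by (intro eq_matI) (auto simp: mat_delete_def del_col_def)

context
  fixes R :: "'a ring" and X :: "'a mat" and n :: nat
  assumes R: "field R" and X: "X \<in> carrier_mat n (Suc n)" "elements_mat X \<subseteq> carrier R"
begin

interpretation field R by (rule R)

lemma minor_vec_closed: "minor_vec R X j \<in> carrier R"
  using ring_det_closed[OF is_cring del_col_carrier[OF X(1)] elements_del_col[OF X]]
  by (simp add: minor_vec_def)

lemma minor_vec_eq_zero_iff: "minor_vec R X j = \<zero>\<^bsub>R\<^esub> \<longleftrightarrow> ring_det R (del_col X j) = \<zero>\<^bsub>R\<^esub>"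
  using ring_det_closed[OF is_cring del_col_carrier[OF X(1)] elements_del_col[OF X]]
  by (auto simp: minor_vec_def l_minus)

lemma ring_det_cons_row:
  assumes x: "\<And>j. j < Suc n \<Longrightarrow> x j \<in> carrier R"
  shows "ring_det R (cons_row x X) = dot R (Suc n) x (minor_vec R X)"
proof -
  have M: "cons_row x X \<in> carrier_mat (Suc n) (Suc n)"
    using X by (auto simp: cons_row_def)
  have el: "elements_mat (cons_row x X) \<subseteq> carrier R"
    unfolding elements_mat_subset_iff[OF M] using x X elements_mat_index[OF X(2)]
    by (auto simp: cons_row_def)
  have "mat_delete (cons_row x X) 0 j = del_col X j" if "j < Suc n" for j
    using X by (intro eq_matI) (auto simp: mat_delete_def del_col_def cons_row_def)
  then have "ring_cofactor R (cons_row x X) 0 j = minor_vec R X j" if "j < Suc n" for j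
    using that by (simp add: ring_cofactor_def minor_vec_def)
  moreover have "cons_row x X $$ (0, j) = x j" if "j < Suc n" for j
    using X that by (simp add: cons_row_def)
  ultimately show ?thesis
    unfolding ring_laplace_row[OF is_cring M el zero_less_Suc] dot_def
    using x minor_vec_closed by (intro finsum_cong') auto
qed

text \<open>Placing a copy of row \<open>i\<close> on top of \<open>X\<close> gives a square matrix
  with two equal rows, and the dot product is its determinant.\<close>

lemma dot_row_minor_vec:
  assumes i: "i < n"
  shows "dot R (Suc n) (\<lambda>j. X $$ (i, j)) (minor_vec R X) = \<zero>\<^bsub>R\<^esub>"
proof -
  let ?M = "cons_row (\<lambda>j. X $$ (i, j)) X"
  have M: "?M \<in> carrier_mat (Suc n) (Suc n)"
    using X by (auto simp: cons_row_def)
  have row: "X $$ (i, j) \<in> carrier R" if "j < Suc n" for j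
    using elements_mat_index[OF X(2)] X(1) i that by simp
  have el: "elements_mat ?M \<subseteq> carrier R"
    unfolding elements_mat_subset_iff[OF M] using X elements_mat_index[OF X(2)] i
    by (auto simp: cons_row_def)
  have "ring_det R ?M = \<zero>\<^bsub>R\<^esub>"
    using X i by (intro ring_det_identical_rows[OF is_cring M el, of 0 "Suc i"]) (auto simp: cons_row_def)
  then show ?thesis
    using ring_det_cons_row[of "\<lambda>j. X $$ (i, j)"] row by simp
qed

end

text \<open>
  Up to sign, the minor of \<open>X\<close> omitting the last column is a linear form in column \<open>j\<close> of \<open>X\<close>,
  whose coefficients only involve the remaining columns \<open>M = del_col X j\<close>.
\<close>

definition column_form :: "'a ring \<Rightarrow> nat \<Rightarrow> 'a mat \<Rightarrow> nat \<Rightarrow> 'a" where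
  "column_form R j M i =
     (if even (i + j) then \<one>\<^bsub>R\<^esub> else \<ominus>\<^bsub>R\<^esub> \<one>\<^bsub>R\<^esub>) \<otimes>\<^bsub>R\<^esub> ring_det R (mat_delete M i (dim_row M - 1))"

lemma ring_det_mat_delete_closed:
  assumes R: "cring R" and M: "M \<in> carrier_mat n n" "elements_mat M \<subseteq> carrier R"
    and "i < n" "j < n"
  shows "ring_det R (mat_delete M i j) \<in> carrier R"
proof (rule ring_det_closed[OF R mat_delete_carrier[OF M(1)]])
  show "elements_mat (mat_delete M i j) \<subseteq> carrier R"
    unfolding elements_mat_subset_iff[OF mat_delete_carrier[OF M(1)]]
    using M elements_mat_index[OF M(2)] assms(4,5) by (auto simp: mat_delete_def)
qed

lemma column_form_closed:
  assumes "cring R" "M \<in> carrier_mat n n" "elements_mat M \<subseteq> carrier R" "i < n"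
  shows "column_form R j M i \<in> carrier R"
proof -
  interpret cring R by fact
  show ?thesis
    using ring_det_mat_delete_closed[OF assms(1-4), of "n - 1"] assms by (simp add: column_form_def)
qed

text \<open>Up to sign the coefficients are the cofactors of \<open>M\<close> along its last column;
  if all vanished, so would the determinant. Hence the zeros of the form make up a proper
  hyperplane.\<close>

lemma column_form_nonzero:
  assumes "field R" and M: "M \<in> carrier_mat n n" "elements_mat M \<subseteq> carrier R"
    and n: "n \<ge> 1" and det: "ring_det R M \<noteq> \<zero>\<^bsub>R\<^esub>"
  obtains i where "i < n" "column_form R j M i \<noteq> \<zero>\<^bsub>R\<^esub>"
proof -
  interpret field R by fact
  have "\<exists>i<n. column_form R j M i \<noteq> \<zero>\<^bsub>R\<^esub>"
  proof (rule ccontr)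
    assume "\<not> ?thesis"
    then have "ring_det R (mat_delete M i (n - 1)) = \<zero>\<^bsub>R\<^esub>" if "i < n" for i
      using that M n ring_det_mat_delete_closed[OF is_cring M that, of "n - 1"]
      by (auto simp: column_form_def l_minus split: if_splits)
    moreover have "M $$ (i, n - 1) \<in> carrier R" if "i < n" for i
      using elements_mat_index[OF M(2)] M(1) n that by simp
    ultimately have "(\<Oplus>\<^bsub>R\<^esub>i\<in>{..<n}. M $$ (i, n - 1) \<otimes>\<^bsub>R\<^esub> ring_cofactor R M i (n - 1)) =
        (\<Oplus>\<^bsub>R\<^esub>i\<in>{..<n}. \<zero>\<^bsub>R\<^esub>)"
      by (intro finsum_cong') (auto simp: ring_cofactor_def)
    then show False
      using det ring_laplace_column[OF is_cring M, of "n - 1"] n by simp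
  qed
  with that show thesis
    by blast
qed

text \<open>Laplace expansion along column \<open>j\<close>, which keeps its position when the last
  column is removed; \<open>mat_delete_del_col_last\<close> expresses the cofactors through
  \<open>del_col X j\<close>.\<close>

lemma dot_column_form:
  assumes "field R" and X: "X \<in> carrier_mat n (Suc n)" "elements_mat X \<subseteq> carrier R" and j: "j < n"
  shows "ring_det R (del_col X n) = dot R n (\<lambda>i. X $$ (i, j)) (column_form R j (del_col X j))"
proof -
  interpret field R by fact
  note M = del_col_carrier[OF X(1), of j] elements_del_col[OF X, of j]
  have "ring_cofactor R (del_col X n) i j = column_form R j (del_col X j) i" if "i < n" for i
    using M mat_delete_del_col_last[OF X(1) that j] by (simp add: ring_cofactor_def column_form_def)
  moreover have "del_col X n $$ (i, j) = X $$ (i, j)" if "i < n" for i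
    using X that j by (simp add: del_col_def)
  moreover have "X $$ (i, j) \<in> carrier R" if "i < n" for i
    using elements_mat_index[OF X(2)] X(1) j that by simp
  ultimately show ?thesis
    unfolding ring_laplace_column[OF is_cring del_col_carrier[OF X(1)] elements_del_col[OF X] j] dot_def
    using column_form_closed[OF is_cring M] by (intro finsum_cong') auto
qed

section \<open>Matrices with entries in a given set\<close>

definition mats :: "nat \<Rightarrow> nat \<Rightarrow> 'a set \<Rightarrow> 'a mat set" where
  "mats n m A = {M \<in> carrier_mat n m. elements_mat M \<subseteq> A}"

lemma mats_index: "M \<in> mats n m A \<Longrightarrow> i < n \<Longrightarrow> j < m \<Longrightarrow> M $$ (i, j) \<in> A"
  using elements_mat_index[of M A i j] by (auto simp: mats_def)

lemma del_col_mats: "X \<in> mats n (Suc m) A \<Longrightarrow> del_col X j \<in> mats n m A"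
  using del_col_carrier[of X n m j] elements_del_col[of X n m A j] by (simp add: mats_def)

lemma det_count_eq: "det_count R k A t = card {M \<in> mats k k A. ring_det R M = t}"
  by (simp add: det_count_def mats_def)

lemma finite_card_mats:
  assumes "finite A"
  shows "finite (mats n m A)" "card (mats n m A) \<le> card A ^ (n * m)"
proof -
  let ?P = "({..<n} \<times> {..<m}) \<rightarrow>\<^sub>E A"
  have inj: "inj_on (\<lambda>X. restrict (($$) X) ({..<n} \<times> {..<m})) (mats n m A)"
  proof (rule inj_onI)
    fix X Y assume X: "X \<in> mats n m A" and Y: "Y \<in> mats n m A"
      and eq: "restrict (($$) X) ({..<n} \<times> {..<m}) = restrict (($$) Y) ({..<n} \<times> {..<m})"
    have "X $$ (i, j) = Y $$ (i, j)" if "i < n" "j < m" for i j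
      using fun_cong[OF eq, of "(i, j)"] that by simp
    then show "X = Y"
      using X Y by (intro eq_matI) (auto simp: mats_def)
  qed
  have sub: "(\<lambda>X. restrict (($$) X) ({..<n} \<times> {..<m})) ` mats n m A \<subseteq> ?P"
    using mats_index by (intro image_subsetI) (force simp: restrict_PiE_iff)
  have fin: "finite ?P"
    using assms by (intro finite_PiE) auto
  show "finite (mats n m A)"
    using inj_on_finite[OF inj sub fin] .
  show "card (mats n m A) \<le> card A ^ (n * m)"
    using card_inj_on_le[OF inj sub fin] by (simp add: card_PiE card_cartesian_product)
qed

lemma mats_eqI:
  assumes X: "X \<in> mats n (Suc n) A" and Y: "Y \<in> mats n (Suc n) A"
    and del: "del_col X k = del_col Y k" and k: "k < Suc n"
    and col: "\<And>i. i < n \<Longrightarrow> X $$ (i, k) = Y $$ (i, k)"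
  shows "X = Y"
proof (rule eq_matI)
  have XY: "X \<in> carrier_mat n (Suc n)" "Y \<in> carrier_mat n (Suc n)"
    using X Y by (simp_all add: mats_def)
  then show "dim_row X = dim_row Y" "dim_col X = dim_col Y"
    by auto
  fix i j assume "i < dim_row Y" "j < dim_col Y"
  then show "X $$ (i, j) = Y $$ (i, j)"
    using col mat_eq_of_del_col_eq[OF XY del _ _ _ k] XY by (cases "j = k") auto
qed

section \<open>Pairs of matrices with equal minors, and the recursive bound\<close>

context
  fixes R :: "'a ring" and A :: "'a set" and n :: nat
  assumes R: "field R" and fin: "finite (carrier R)" and A: "A \<subseteq> carrier R" and n: "n \<ge> 1"
begin

interpretation field R by (rule R)

lemma finite_entries: "finite A"
  using A fin by (rule finite_subset)

lemma mats_carrier: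
  assumes "X \<in> mats k m A"
  shows "X \<in> carrier_mat k m" "elements_mat X \<subseteq> carrier R"
  using assms A by (auto simp: mats_def)

text \<open>Row \<open>i\<close> of either matrix is orthogonal to the common vector of minors. The
  rows agree away from \<open>k\<close>, and the \<open>k\<close>-th coefficient is nonzero, so they
  agree at \<open>k\<close> too.\<close>

lemma eq_if_minor_vec_eq:
  assumes X: "X \<in> mats n (Suc n) A" and Y: "Y \<in> mats n (Suc n) A"
    and del: "del_col X k = del_col Y k" and k: "k < Suc n"
    and w: "\<And>j. j < Suc n \<Longrightarrow> minor_vec R X j = minor_vec R Y j" and nz: "minor_vec R X k \<noteq> \<zero>\<^bsub>R\<^esub>"
  shows "X = Y"
proof (rule mats_eqI[OF X Y del k])
  fix i assume i: "i < n"
  have entries: "Z $$ (i, j) \<in> carrier R" if "Z \<in> mats n (Suc n) A" "j < Suc n" for Z j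
    using mats_index[OF that(1) i that(2)] A by blast
  have "dot R (Suc n) (\<lambda>j. Y $$ (i, j)) (minor_vec R X) = dot R (Suc n) (\<lambda>j. Y $$ (i, j)) (minor_vec R Y)"
    by (rule dot_cong) (use w entries[OF Y] minor_vec_closed[OF R mats_carrier[OF Y]] in simp_all)
  then have "dot R (Suc n) (\<lambda>j. X $$ (i, j)) (minor_vec R X) = dot R (Suc n) (\<lambda>j. Y $$ (i, j)) (minor_vec R X)"
    using dot_row_minor_vec[OF R mats_carrier[OF X] i] dot_row_minor_vec[OF R mats_carrier[OF Y] i] by simp
  moreover have "X $$ (i, j) = Y $$ (i, j)" if "j < Suc n" "j \<noteq> k" for j
    using mat_eq_of_del_col_eq[OF mats_carrier(1)[OF X] mats_carrier(1)[OF Y] del i that k] .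
  ultimately show "X $$ (i, k) = Y $$ (i, k)"
    using entries[OF X] entries[OF Y] minor_vec_closed[OF R mats_carrier[OF X]] k nz
      dot_eq_imp_component_eq[of "Suc n" "\<lambda>j. X $$ (i, j)" "minor_vec R X" "\<lambda>j. Y $$ (i, j)" k]
    by blast
qed

text \<open>
  A pair \<open>(X, X')\<close> with a common vector of minors \<open>w\<close>, \<open>w k \<noteq> 0\<close>, is determined by its two
  \<open>k\<close>-th minors and column \<open>k\<close> of \<open>X\<close>: these yield \<open>X\<close>, hence \<open>w\<close>, and \<open>w\<close> is orthogonal to the
  rows of \<open>X'\<close>, which determines column \<open>k\<close> of \<open>X'\<close>.
\<close>

lemma card_minor_pairs_le:
  fixes C :: "'a mat \<Rightarrow> (nat \<Rightarrow> 'a) set" and Q :: "('a mat \<times> 'a mat) set"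
  assumes k: "k < Suc n" and Q: "Q \<subseteq> mats n (Suc n) A \<times> mats n (Suc n) A"
    and w: "\<And>X X' j. (X, X') \<in> Q \<Longrightarrow> j < Suc n \<Longrightarrow> minor_vec R X j = minor_vec R X' j"
    and nz: "\<And>X X'. (X, X') \<in> Q \<Longrightarrow> minor_vec R X k \<noteq> \<zero>\<^bsub>R\<^esub>"
    and C: "\<And>X X'. (X, X') \<in> Q \<Longrightarrow> (\<lambda>i\<in>{..<n}. X $$ (i, k)) \<in> C (del_col X k)"
    and C_fin: "\<And>M. finite (C M)"
    and C_card: "\<And>M. M \<in> mats n n A \<Longrightarrow> ring_det R M \<noteq> \<zero>\<^bsub>R\<^esub> \<Longrightarrow> card (C M) \<le> b"
  shows "real (card Q) \<le> real b * (\<Sum>t\<in>carrier R - {\<zero>\<^bsub>R\<^esub>}. (real (det_count R n A t))\<^sup>2)"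
proof -
  let ?N = "{M \<in> mats n n A. ring_det R M \<noteq> \<zero>\<^bsub>R\<^esub>}"
  let ?T = "{(M, M') \<in> ?N \<times> ?N. ring_det R M = ring_det R M'}"
  let ?col = "\<lambda>X :: 'a mat. \<lambda>i\<in>{..<n}. X $$ (i, k)"
  let ?f = "\<lambda>(X, X'). ((del_col X k, del_col X' k), ?col X)"
  have finN: "finite ?N"
    using finite_card_mats(1)[OF finite_entries] by simp
  have finT: "finite ?T"
    by (rule finite_subset[of _ "?N \<times> ?N"]) (use finN in auto)
  have det_carrier: "ring_det R M \<in> carrier R" if "M \<in> ?N" for M
    using that ring_det_closed[OF is_cring mats_carrier] by blast

  have "inj_on ?f Q"
  proof (rule inj_onI)
    fix z z' assume z: "z \<in> Q" and z': "z' \<in> Q" and eq: "?f z = ?f z'"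
    obtain X X' Y Y' where z_eq: "z = (X, X')" "z' = (Y, Y')"
      by (cases z, cases z')
    note zQ = z[unfolded z_eq] and zQ' = z'[unfolded z_eq]
    have mem: "X \<in> mats n (Suc n) A" "X' \<in> mats n (Suc n) A" "Y \<in> mats n (Suc n) A" "Y' \<in> mats n (Suc n) A"
      using zQ zQ' Q by auto
    have del: "del_col X k = del_col Y k" "del_col X' k = del_col Y' k" and col: "?col X = ?col Y"
      using eq by (simp_all add: z_eq)
    have "X $$ (i, k) = Y $$ (i, k)" if "i < n" for i
      using fun_cong[OF col, of i] that by simp
    then have XY: "X = Y"
      by (rule mats_eqI[OF mem(1,3) del(1) k])
    have "X' = Y'"
    proof (rule eq_if_minor_vec_eq[OF mem(2,4) del(2) k])
      \<comment> \<open>The vectors of minors agree along the chain \<open>X'\<close>,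
        \<open>X = Y\<close>, \<open>Y'\<close>.\<close>
      show "minor_vec R X' j = minor_vec R Y' j" if "j < Suc n" for j
        using w[OF zQ that] w[OF zQ' that] XY by simp
      show "minor_vec R X' k \<noteq> \<zero>\<^bsub>R\<^esub>"
        using nz[OF zQ] w[OF zQ k] by simp
    qed
    with XY show "z = z'"
      by (simp add: z_eq)
  qed
  \<comment> \<open>Both \<open>k\<close>-th minors carry the same sign in \<open>minor_vec\<close>,
    so the two determinants are equal and nonzero.\<close>
  moreover have "?f ` Q \<subseteq> (SIGMA p:?T. C (fst p))"
  proof (rule image_subsetI)
    fix z assume "z \<in> Q"
    then obtain X X' where z: "z = (X, X')" "(X, X') \<in> Q"
      by (cases z) auto
    then have mem: "X \<in> mats n (Suc n) A" "X' \<in> mats n (Suc n) A"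
      using Q by auto
    note minor = minor_vec_eq_zero_iff[OF R mats_carrier[OF mem(1)]]
      minor_vec_eq_zero_iff[OF R mats_carrier[OF mem(2)]]
    have nz1: "ring_det R (del_col X k) \<noteq> \<zero>\<^bsub>R\<^esub>" and nz2: "ring_det R (del_col X' k) \<noteq> \<zero>\<^bsub>R\<^esub>"
      using nz[OF z(2)] w[OF z(2) k] minor(1)[of k] minor(2)[of k] by metis+
    have dets: "ring_det R (del_col X k) \<in> carrier R" "ring_det R (del_col X' k) \<in> carrier R"
      using ring_det_closed[OF is_cring mats_carrier[OF del_col_mats[OF mem(1)]]]
        ring_det_closed[OF is_cring mats_carrier[OF del_col_mats[OF mem(2)]]] by simp_all
    have "ring_det R (del_col X k) = ring_det R (del_col X' k)"
      using w[OF z(2) k] dets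
      by (cases "even k") (simp_all add: minor_vec_def l_minus, metis dets minus_minus)
    then show "?f z \<in> (SIGMA p:?T. C (fst p))"
      using nz1 nz2 mem C[OF z(2)] by (simp add: z del_col_mats)
  qed
  moreover have "finite (SIGMA p:?T. C (fst p))"
    using finT C_fin by (rule finite_SigmaI)
  ultimately have "card Q \<le> card (SIGMA p:?T. C (fst p))"
    by (rule card_inj_on_le)
  also have "\<dots> = (\<Sum>p\<in>?T. card (C (fst p)))"
    using finT C_fin by simp
  also have "\<dots> \<le> (\<Sum>p\<in>?T. b)"
    using C_card by (intro sum_mono) auto
  finally have "card Q \<le> b * card ?T"
    by (simp add: mult.commute)
  then have "real (card Q) \<le> real b * real (card ?T)"
    by (simp flip: of_nat_mult)
  \<comment> \<open>Pairs with equal nonzero determinant are grouped by its value.\<close>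
  also have "real (card ?T) =
      (\<Sum>t\<in>carrier R - {\<zero>\<^bsub>R\<^esub>}. (real (card {M \<in> ?N. ring_det R M = t}))\<^sup>2)"
    using det_carrier finN fin by (intro sum_card_fibre_squared[symmetric]) auto
  also have "\<dots> = (\<Sum>t\<in>carrier R - {\<zero>\<^bsub>R\<^esub>}. (real (det_count R n A t))\<^sup>2)"
    unfolding det_count_eq by (intro sum.cong refl arg_cong[of _ _ "\<lambda>S. (real (card S))\<^sup>2"]) auto
  finally show ?thesis .
qed


text \<open>A nonzero vector of minors has either a nonzero last entry or a zero last entry and some
  nonzero earlier one. The first case costs \<open>card A ^ n\<close> columns, each of the
  \<open>n\<close> positions in the second only \<open>card A ^ (n - 1)\<close>.\<close>

lemma card_minor_vec_collisions_le:
  defines "\<Omega> \<equiv> {X \<in> mats n (Suc n) A. \<exists>j<Suc n. minor_vec R X j \<noteq> \<zero>\<^bsub>R\<^esub>}"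
  shows "real (card {(X, X') \<in> \<Omega> \<times> \<Omega>. \<forall>j<Suc n. minor_vec R X j = minor_vec R X' j}) \<le>
    (real (card A) ^ n + real n * real (card A) ^ (n - 1)) *
      (\<Sum>t\<in>carrier R - {\<zero>\<^bsub>R\<^esub>}. (real (det_count R n A t))\<^sup>2)"
proof -
  let ?Q = "{(X, X') \<in> \<Omega> \<times> \<Omega>. \<forall>j<Suc n. minor_vec R X j = minor_vec R X' j}"
  let ?S = "\<Sum>t\<in>carrier R - {\<zero>\<^bsub>R\<^esub>}. (real (det_count R n A t))\<^sup>2"
  \<comment> \<open>For \<open>k = n\<close> the implication is vacuous, so \<open>Q n\<close> holds
    all pairs with nonzero last minor. The sets for \<open>k < n\<close> may overlap, which a union
    bound tolerates.\<close>
  define Q where "Q k = {(X, X') \<in> ?Q. minor_vec R X k \<noteq> \<zero>\<^bsub>R\<^esub> \<and> (k < n \<longrightarrow> minor_vec R X n = \<zero>\<^bsub>R\<^esub>)}" for k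
  have finPi: "finite ({..<n} \<rightarrow>\<^sub>E A)"
    using finite_entries by (intro finite_PiE) auto
  have Q_mats: "Q k \<subseteq> mats n (Suc n) A \<times> mats n (Suc n) A" for k
    by (auto simp: Q_def \<Omega>_def)
  have Q_w: "minor_vec R X j = minor_vec R X' j" if "(X, X') \<in> Q k" "j < Suc n" for X X' j k
    using that by (auto simp: Q_def)
  have Q_nz: "minor_vec R X k \<noteq> \<zero>\<^bsub>R\<^esub>" if "(X, X') \<in> Q k" for X X' k
    using that by (auto simp: Q_def)
  have col: "(\<lambda>i\<in>{..<n}. X $$ (i, k)) \<in> {..<n} \<rightarrow>\<^sub>E A" if "(X, X') \<in> Q k" "k < Suc n" for X X' k
    using Q_mats that mats_index[of X n "Suc n" A] by (auto simp: restrict_PiE_iff)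

  have last: "real (card (Q n)) \<le> real (card A ^ n) * ?S"
  proof (rule card_minor_pairs_le[where C = "\<lambda>_. {..<n} \<rightarrow>\<^sub>E A", OF lessI Q_mats Q_w Q_nz])
    show "(\<lambda>i\<in>{..<n}. X $$ (i, n)) \<in> {..<n} \<rightarrow>\<^sub>E A" if "(X, X') \<in> Q n" for X X'
      using col[OF that] by simp
  qed (use finPi in \<open>simp_all add: card_PiE\<close>)
  \<comment> \<open>The vanishing last minor is a linear condition on column \<open>k\<close>, with
    coefficients fixed by the other columns; this saves one factor \<open>card A\<close>.\<close>
  have other: "real (card (Q k)) \<le> real (card A ^ (n - 1)) * ?S" if k: "k < n" for k
  proof (rule card_minor_pairs_le[where k = k and Q = "Q k" and
      C = "\<lambda>M. {c \<in> {..<n} \<rightarrow>\<^sub>E A. dot R n c (column_form R k M) = \<zero>\<^bsub>R\<^esub>}", OF _ Q_mats Q_w Q_nz])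
    show "k < Suc n"
      using k by simp
    fix X X' assume Q: "(X, X') \<in> Q k"
    then have X: "X \<in> mats n (Suc n) A" and zero: "minor_vec R X n = \<zero>\<^bsub>R\<^esub>"
      using Q_mats k by (auto simp: Q_def)
    note M = del_col_mats[OF X, of k]
    have entries: "X $$ (i, k) \<in> carrier R" if "i < n" for i
      using mats_index[OF X that] k A by force
    have "dot R n (\<lambda>i\<in>{..<n}. X $$ (i, k)) (column_form R k (del_col X k)) =
        dot R n (\<lambda>i. X $$ (i, k)) (column_form R k (del_col X k))"
      by (rule dot_cong) (use entries column_form_closed[OF is_cring mats_carrier[OF M]] in simp_all)
    also have "\<dots> = \<zero>\<^bsub>R\<^esub>"
      using dot_column_form[OF R mats_carrier[OF X] k] zero
        minor_vec_eq_zero_iff[OF R mats_carrier[OF X]] by simp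
    finally show "(\<lambda>i\<in>{..<n}. X $$ (i, k)) \<in>
        {c \<in> {..<n} \<rightarrow>\<^sub>E A. dot R n c (column_form R k (del_col X k)) = \<zero>\<^bsub>R\<^esub>}"
      using col[OF Q] k by simp
  next
    fix M assume M: "M \<in> mats n n A" "ring_det R M \<noteq> \<zero>\<^bsub>R\<^esub>"
    obtain i where i: "i < n" "column_form R k M i \<noteq> \<zero>\<^bsub>R\<^esub>"
      using column_form_nonzero[OF R mats_carrier[OF M(1)] n M(2)] by blast
    show "card {c \<in> {..<n} \<rightarrow>\<^sub>E A. dot R n c (column_form R k M) = \<zero>\<^bsub>R\<^esub>} \<le> card A ^ (n - 1)"
      by (rule card_hyperplane_le[where g = "column_form R k M", OF finite_entries A _ i])
        (rule column_form_closed[OF is_cring mats_carrier[OF M(1)]])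
  qed (use finPi in auto)

  have finQ: "finite (Q k)" for k
    by (rule finite_subset[OF Q_mats]) (intro finite_cartesian_product finite_card_mats(1) finite_entries)
  have "?Q \<subseteq> (\<Union>k<Suc n. Q k)"
  proof
    fix z assume z: "z \<in> ?Q"
    obtain X X' where z_eq: "z = (X, X')"
      by (cases z)
    have "\<exists>k<Suc n. minor_vec R X k \<noteq> \<zero>\<^bsub>R\<^esub> \<and> (k < n \<longrightarrow> minor_vec R X n = \<zero>\<^bsub>R\<^esub>)"
      using z by (cases "minor_vec R X n = \<zero>\<^bsub>R\<^esub>") (auto simp: z_eq \<Omega>_def)
    then show "z \<in> (\<Union>k<Suc n. Q k)"
      using z unfolding z_eq Q_def by blast
  qed
  then have "card ?Q \<le> card (\<Union>k<Suc n. Q k)"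
    using finQ by (intro card_mono) auto
  also have "\<dots> \<le> (\<Sum>k<Suc n. card (Q k))"
    by (rule card_UN_le) simp
  finally have "real (card ?Q) \<le> (\<Sum>k<n. real (card (Q k))) + real (card (Q n))"
    by (simp flip: of_nat_sum of_nat_add)
  also have "\<dots> \<le> (\<Sum>k<n. real (card A ^ (n - 1)) * ?S) + real (card A ^ n) * ?S"
    using other last by (intro add_mono sum_mono) simp_all
  finally show ?thesis
    by (simp add: algebra_simps)
qed

text \<open>Each matrix splits into its first row and the block below. If all minors of the block
  vanished, the determinant would be zero, so a nonzero \<open>l\<close> forces a nonzero vector of
  minors.\<close>

lemma det_count_le_card_dot:
  assumes l: "l \<noteq> \<zero>\<^bsub>R\<^esub>"
  shows "det_count R (Suc n) A l \<le> card {(x, X) \<in> ({..<Suc n} \<rightarrow>\<^sub>E A) \<times>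
      {X \<in> mats n (Suc n) A. \<exists>j<Suc n. minor_vec R X j \<noteq> \<zero>\<^bsub>R\<^esub>}.
    dot R (Suc n) x (minor_vec R X) = l}"
proof -
  let ?P = "{..<Suc n} \<rightarrow>\<^sub>E A" and ?\<Omega> = "{X \<in> mats n (Suc n) A. \<exists>j<Suc n. minor_vec R X j \<noteq> \<zero>\<^bsub>R\<^esub>}"
  let ?H = "{(x, X) \<in> ?P \<times> ?\<Omega>. dot R (Suc n) x (minor_vec R X) = l}"
  have mem: "x j \<in> carrier R" if "x \<in> ?P" "j < Suc n" for x j
    using that A PiE_mem[of x "{..<Suc n}" "\<lambda>_. A" j] by blast
  have "{M \<in> mats (Suc n) (Suc n) A. ring_det R M = l} \<subseteq> (\<lambda>(x, X). cons_row x X) ` ?H"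
  proof
    fix M assume M: "M \<in> {M \<in> mats (Suc n) (Suc n) A. ring_det R M = l}"
    let ?x = "\<lambda>j\<in>{..<Suc n}. M $$ (0, j)" and ?X = "mat n (Suc n) (\<lambda>(i, j). M $$ (Suc i, j))"
    have entries: "M $$ (i, j) \<in> A" if "i < Suc n" "j < Suc n" for i j
      using M mats_index that by blast
    have x: "?x \<in> ?P"
      using entries by (simp add: restrict_PiE_iff)
    have X: "?X \<in> mats n (Suc n) A"
      using entries elements_mat_subset_iff[of ?X n "Suc n" A] by (simp add: mats_def)
    have eq: "M = cons_row ?x ?X"
      using M by (intro eq_matI) (auto simp: cons_row_def mats_def)
    have dot: "dot R (Suc n) ?x (minor_vec R ?X) = l"
      using ring_det_cons_row[OF R mats_carrier[OF X], of ?x] mem[OF x] M unfolding eq[symmetric] by simp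
    have "\<exists>j<Suc n. minor_vec R ?X j \<noteq> \<zero>\<^bsub>R\<^esub>"
    proof (rule ccontr)
      assume "\<not> ?thesis"
      then have "dot R (Suc n) ?x (minor_vec R ?X) = (\<Oplus>\<^bsub>R\<^esub>j\<in>{..<Suc n}. \<zero>\<^bsub>R\<^esub>)"
        unfolding dot_def using mem[OF x] by (intro finsum_cong') simp_all
      then show False
        using dot l by simp
    qed
    then have "(?x, ?X) \<in> ?H"
      using x X dot by simp
    then show "M \<in> (\<lambda>(x, X). cons_row x X) ` ?H"
      using eq by (intro image_eqI[of _ _ "(?x, ?X)"]) simp_all
  qed
  moreover have "finite ?H"
  proof (rule finite_subset)
    show "?H \<subseteq> ?P \<times> mats n (Suc n) A"
      by auto
    show "finite (?P \<times> mats n (Suc n) A)"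
      using finite_card_mats(1)[OF finite_entries] finite_entries
      by (intro finite_cartesian_product finite_PiE) auto
  qed
  ultimately show ?thesis
    unfolding det_count_eq by (meson surj_card_le)
qed

lemma sum_det_count_squared_le:
  defines "a \<equiv> real (card A)" and "q \<equiv> real (card (carrier R))"
  shows "(\<Sum>l\<in>carrier R - {\<zero>\<^bsub>R\<^esub>}. (real (det_count R (Suc n) A l))\<^sup>2) \<le>
      a ^ (2 * (Suc n)\<^sup>2) / q + q ^ n * a ^ (2 * Suc n) * (1 + n / a) *
        (\<Sum>t\<in>carrier R - {\<zero>\<^bsub>R\<^esub>}. (real (det_count R n A t))\<^sup>2)"
proof -
  let ?P = "{..<Suc n} \<rightarrow>\<^sub>E A" and ?\<Omega> = "{X \<in> mats n (Suc n) A. \<exists>j<Suc n. minor_vec R X j \<noteq> \<zero>\<^bsub>R\<^esub>}"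
  let ?S = "\<Sum>t\<in>carrier R - {\<zero>\<^bsub>R\<^esub>}. (real (det_count R n A t))\<^sup>2"
  let ?E = "real (card {(X, X') \<in> ?\<Omega> \<times> ?\<Omega>. \<forall>j<Suc n. minor_vec R X j = minor_vec R X' j})"
  have finM: "finite (mats n (Suc n) A)"
    using finite_card_mats(1)[OF finite_entries] .
  have "(\<Sum>l\<in>carrier R - {\<zero>\<^bsub>R\<^esub>}. (real (det_count R (Suc n) A l))\<^sup>2) \<le>
      (\<Sum>l\<in>carrier R - {\<zero>\<^bsub>R\<^esub>}.
        (real (card {(x, X) \<in> ?P \<times> ?\<Omega>. dot R (Suc n) x (minor_vec R X) = l}))\<^sup>2)"
    using det_count_le_card_dot by (intro sum_mono power_mono of_nat_mono) auto
  also have "\<dots> \<le> (a ^ Suc n * real (card ?\<Omega>))\<^sup>2 / q + a ^ (Suc n + 1) * q ^ (Suc n - 1) * ?E"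
    unfolding a_def q_def
  proof (rule sum_squares_dot_count_le[OF fin _ A])
    show "minor_vec R X j \<in> carrier R" if "X \<in> ?\<Omega>" for X j
      using that minor_vec_closed[OF R mats_carrier] by blast
  qed (use finM in simp_all)
  \<comment> \<open>The trivial count of blocks suffices: the first row and the block have
    \<open>(Suc n)\<^sup>2\<close> entries together.\<close>
  also have "(a ^ Suc n * real (card ?\<Omega>))\<^sup>2 / q \<le> a ^ (2 * (Suc n)\<^sup>2) / q"
  proof (rule divide_right_mono)
    have "card ?\<Omega> \<le> card A ^ (n * Suc n)"
      using card_mono[OF finM, of ?\<Omega>] finite_card_mats(2)[OF finite_entries, of n "Suc n"] by force
    then have "real (card ?\<Omega>) \<le> a ^ (n * Suc n)"
      unfolding a_def of_nat_power[symmetric] of_nat_le_iff .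
    then have "(a ^ Suc n * real (card ?\<Omega>))\<^sup>2 \<le> (a ^ Suc n * a ^ (n * Suc n))\<^sup>2"
      by (intro power_mono mult_left_mono) (simp_all add: a_def)
    also have "\<dots> = a ^ (2 * (Suc n)\<^sup>2)"
    proof -
      have "Suc n + n * Suc n = (Suc n)\<^sup>2"
        by (simp add: power2_eq_square)
      then show ?thesis
        by (simp only: mult.commute[of 2] flip: power_add power_mult)
    qed
    finally show "(a ^ Suc n * real (card ?\<Omega>))\<^sup>2 \<le> a ^ (2 * (Suc n)\<^sup>2)" .
  qed (simp add: q_def)
  also have "a ^ (Suc n + 1) * q ^ (Suc n - 1) * ?E \<le>
      a ^ (Suc n + 1) * q ^ (Suc n - 1) * ((a ^ n + n * a ^ (n - 1)) * ?S)"
    using card_minor_vec_collisions_le unfolding a_def q_def by (intro mult_left_mono) simp_all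
  also have "\<dots> = q ^ n * (a ^ (Suc n + 1) * (a ^ n + n * a ^ (n - 1))) * ?S"
    by simp
  \<comment> \<open>The exponents \<open>n + 2\<close> and \<open>n\<close> add up to
    \<open>2 * Suc n\<close>; at \<open>a = 0\<close> both sides vanish because of the leading
    powers.\<close>
  also have "a ^ (Suc n + 1) * (a ^ n + n * a ^ (n - 1)) = a ^ (2 * Suc n) * (1 + n / a)"
  proof (cases "a = 0")
    case False
    obtain m where "n = Suc m"
      using n by (cases n) auto
    with False show ?thesis
      by (simp add: field_simps power_add[symmetric] mult_2[symmetric])
  qed simp
  finally show ?thesis
    by (simp only: mult.assoc add_le_cancel_left)
qed

end

text \<open>Both error functions are chosen before the field and the set, so the \<open>o(1)\<close>
  terms depend only on \<open>d\<close> and \<open>card A\<close> and are uniform in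
  \<open>q\<close>.\<close>

theorem theorem8:
  fixes d :: nat
  assumes "d \<ge> 2"
  shows "\<exists>\<epsilon>\<^sub>1 \<epsilon>\<^sub>2 :: nat \<Rightarrow> real. \<epsilon>\<^sub>1 \<longlonglongrightarrow> 0 \<and> \<epsilon>\<^sub>2 \<longlonglongrightarrow> 0 \<and>
    (\<forall>(R :: 'a ring) (A :: 'a set) (p :: nat) (n :: nat) (q :: nat).
       field R \<longrightarrow> prime p \<longrightarrow> odd p \<longrightarrow> n \<ge> 1 \<longrightarrow> q = p ^ n \<longrightarrow> card (carrier R) = q \<longrightarrow>
       A \<subseteq> carrier R \<longrightarrow>
       (\<Sum>l\<in>carrier R - {\<zero>\<^bsub>R\<^esub>}. (real (det_count R d A l))\<^sup>2)
         \<le> (1 + \<epsilon>\<^sub>1 (card A)) * (real (card A) ^ (2 * d\<^sup>2) / real q)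
           + real q ^ (d - 1) * real (card A) ^ (2 * d) * (1 + \<epsilon>\<^sub>2 (card A))
             * (\<Sum>t\<in>carrier R - {\<zero>\<^bsub>R\<^esub>}. (real (det_count R (d - 1) A t))\<^sup>2))"
proof (intro exI conjI allI impI)
  show "(\<lambda>_. 0 :: real) \<longlonglongrightarrow> 0"
    by simp
  show "(\<lambda>k. real (d - 1) / real k) \<longlonglongrightarrow> 0"
    by (rule lim_const_over_n)
  fix R :: "'a ring" and A :: "'a set" and p n q :: nat
  assume R: "field R" and p: "prime p" and q: "q = p ^ n" "card (carrier R) = q" and A: "A \<subseteq> carrier R"
  \<comment> \<open>An infinite carrier would have cardinality \<open>0\<close>, so positivity
    yields finiteness.\<close>
  have "card (carrier R) > 0"
    using p q by (simp add: prime_gt_0_nat)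
  then have fin: "finite (carrier R)"
    by (rule card_ge_0_finite)
  have "Suc (d - 1) = d" "d - 1 \<ge> 1"
    using assms by auto
  with sum_det_count_squared_le[OF R fin A \<open>d - 1 \<ge> 1\<close>]
  show "(\<Sum>l\<in>carrier R - {\<zero>\<^bsub>R\<^esub>}. (real (det_count R d A l))\<^sup>2)
         \<le> (1 + 0) * (real (card A) ^ (2 * d\<^sup>2) / real q)
           + real q ^ (d - 1) * real (card A) ^ (2 * d) * (1 + real (d - 1) / real (card A))
             * (\<Sum>t\<in>carrier R - {\<zero>\<^bsub>R\<^esub>}. (real (det_count R (d - 1) A t))\<^sup>2)"
    by (simp only: q add_0_right mult_1)
qed

end
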